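(* For every uniform matroid $\mathsf{U}_{k,n}$ with $n\ge k\ge 1$, $$Y_{\mathsf{U}_{k,n}}(t)=\sum_{i=0}^{\lfloor k/2\rfloor}\binom{n}{i}\binom{n-i-1}{n-k}t^i+\sum_{i=0}^{\lfloor (k-1)/2\rfloor}\binom{n}{i}\binom{n-i-1}{n-k}t^{k-i}.$$
   Context: $\mathsf{U}_{k,n}$ is the uniform matroid of rank $k$ on ground set $[n]$ whose bases are all $k$-subsets of $[n]$. For a matroid $\mathsf{M}$ on $E$ with rank function $\mathrm{rk}$, $\mathcal{L}(\mathsf{M})$ is its lattice of flats, $\mathsf{M}|_F$ the restriction and $\mathsf{M}/F$ the contraction; $\mathrm{rk}(\mathsf{M}|_F)=\mathrm{rk}(F)$, $\mathrm{rk}(\mathsf{M}/F)=\mathrm{rk}(\mathsf{M})-\mathrm{rk}(F)$. For a loopless matroid $\mathsf{M}$, $\mu_{\mathsf{M}}$ is the value $\mu(\emptyset,E)$ of the Möbius function of $\mathcal{L}(\mathsf{M})$ (so $\mu_{\mathsf{M}}=1$ if $\mathrm{rk}(\mathsf{M})=0$), and $\chi_{\mathsf{M}}(t)=\sum_{F\in\mathcal{L}(\mathsf{M})}\mu_{\mathsf{M}|_F}t^{\mathrm{rk}(\mathsf{M}/F)}$ is its characteristic polynomial. The inverse Kazhdan–Lusztig polynomial $Q_{\mathsf{M}}(t)$ of a loopless matroid is the unique assignment of polynomials such that $Q_{\mathsf{M}}(t)=1$ if $\mathrm{rk}(\mathsf{M})=0$, $\deg Q_{\mathsf{M}}<\mathrm{rk}(\mathsf{M})/2$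 if $\mathrm{rk}(\mathsf{M})>0$, and $(-t)^{\mathrm{rk}(\mathsf{M})}Q_{\mathsf{M}}(t^{-1})=\sum_{F\in\mathcal{L}(\mathsf{M})}(-1)^{\mathrm{rk}(F)}Q_{\mathsf{M}|_F}(t)\,t^{\mathrm{rk}(\mathsf{M}/F)}\chi_{\mathsf{M}/F}(t^{-1})$. For a loopless matroid $\mathsf{M}$ define $\hat Y_{\mathsf{M}}(t)=\sum_{F\in\mathcal{L}(\mathsf{M})}(-1)^{\mathrm{rk}(F)}Q_{\mathsf{M}|_F}(t)\,t^{\mathrm{rk}(\mathsf{M}/F)}\mu_{\mathsf{M}/F}$ and the inverse $Z$-polynomial $Y_{\mathsf{M}}(t)=(-1)^{\mathrm{rk}(\mathsf{M})}\hat Y_{\mathsf{M}}(t)$; if $\mathsf{M}$ has loops, $Y_{\mathsf{M}}(t):=Y_{\mathsf{M}'}(t)$ where $\mathsf{M}'$ is $\mathsf{M}$ with all loops deleted. *)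

theory Defs
  imports Complex_Main "HOL-Computational_Algebra.Polynomial"
begin

section \<open>Matroids\<close>

datatype 'a matroid = Matroid (ground: "'a set") (indep: "'a set set")

definition is_matroid :: "'a matroid \<Rightarrow> bool" where
  "is_matroid M \<longleftrightarrow>
     finite (ground M) \<and> indep M \<subseteq> Pow (ground M) \<and> {} \<in> indep M \<and>
     (\<forall>I\<in>indep M. \<forall>J. J \<subseteq> I \<longrightarrow> J \<in> indep M) \<and>
     (\<forall>I\<in>indep M. \<forall>J\<in>indep M. card I < card J \<longrightarrow> (\<exists>x\<in>J - I. insert x I \<in> indep M))"

definition bases :: "'a matroid \<Rightarrow> 'a set set" where
  "bases M = {B \<in> indep M. \<forall>I\<in>indep M. B \<subseteq> I \<longrightarrow> I = B}"

definition rank_of :: "'a matroid \<Rightarrow> 'a set \<Rightarrow> nat" where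
  "rank_of M S = Max (card ` {I \<in> indep M. I \<subseteq> S})"

definition rk :: "'a matroid \<Rightarrow> nat" where
  "rk M = rank_of M (ground M)"

definition loops :: "'a matroid \<Rightarrow> 'a set" where
  "loops M = {x \<in> ground M. {x} \<notin> indep M}"

definition loopless :: "'a matroid \<Rightarrow> bool" where
  "loopless M \<longleftrightarrow> loops M = {}"

definition flats :: "'a matroid \<Rightarrow> 'a set set" where
  "flats M = {F. F \<subseteq> ground M \<and> (\<forall>x\<in>ground M - F. rank_of M F < rank_of M (insert x F))}"

definition restrict :: "'a matroid \<Rightarrow> 'a set \<Rightarrow> 'a matroid" where
  "restrict M F = Matroid F {I \<in> indep M. I \<subseteq> F}"

definition contract :: "'a matroid \<Rightarrow> 'a set \<Rightarrow> 'a matroid" where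
  "contract M F = Matroid (ground M - F)
     {I. I \<subseteq> ground M - F \<and> (\<exists>B\<in>bases (restrict M F). I \<union> B \<in> indep M)}"

definition delete_loops :: "'a matroid \<Rightarrow> 'a matroid" where
  "delete_loops M = restrict M (ground M - loops M)"

definition matroid_of_bases :: "'a set \<Rightarrow> 'a set set \<Rightarrow> 'a matroid" where
  "matroid_of_bases E \<B> = Matroid E {I. \<exists>B\<in>\<B>. I \<subseteq> B}"

definition uniform :: "nat \<Rightarrow> nat \<Rightarrow> nat matroid" where
  "uniform k n = matroid_of_bases {1..n} {B. B \<subseteq> {1..n} \<and> card B = k}"


section \<open>Moebius function and characteristic polynomial\<close>

text \<open>The Moebius function of a family \<open>L\<close> of finite sets, ordered by inclusion.\<close>

function mobius :: "'a set set \<Rightarrow> 'a set \<Rightarrow> 'a set \<Rightarrow> int" where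
  "mobius L X Y =
     (if X = Y then 1
      else if X \<subset> Y \<and> finite Y then - (\<Sum>Z\<in>{Z \<in> L. X \<subseteq> Z \<and> Z \<subset> Y}. mobius L X Z)
      else 0)"
  by auto
termination
  by (relation "measure (\<lambda>(L, X, Y). card Y)") (auto intro: psubset_card_mono)

declare mobius.simps [simp del]

definition mu :: "'a matroid \<Rightarrow> int" where
  "mu M = mobius (flats M) {} (ground M)"

definition char_poly :: "'a matroid \<Rightarrow> int poly" where
  "char_poly M = (\<Sum>F\<in>flats M. monom (mu (restrict M F)) (rk (contract M F)))"


section \<open>The inverse Kazhdan--Lusztig polynomial\<close>

text \<open>For \<open>degree p \<le> r\<close>, this is the polynomial \<open>t^r p(1/t)\<close>.\<close>

definition reverse_at :: "nat \<Rightarrow> int poly \<Rightarrow> int poly" where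
  "reverse_at r p = (\<Sum>i\<le>r. monom (coeff p i) (r - i))"

definition inverse_KL_conditions :: "('a matroid \<Rightarrow> int poly) \<Rightarrow> 'a matroid \<Rightarrow> bool" where
  "inverse_KL_conditions Q M \<longleftrightarrow>
     (rk M = 0 \<longrightarrow> Q M = 1) \<and>
     (rk M > 0 \<longrightarrow> 2 * degree (Q M) < rk M) \<and>
     (-1) ^ rk M * reverse_at (rk M) (Q M) =
       (\<Sum>F\<in>flats M. (-1) ^ rank_of M F * Q (restrict M F) *
          reverse_at (rk (contract M F)) (char_poly (contract M F)))"

text \<open>
  The conditions at \<open>M\<close> refer to \<open>Q\<close> at the restrictions of \<open>M\<close> to flats only, and such
  restrictions are closed under restricting to flats again.  So it suffices to consider assignments
  on the restrictions of \<open>M\<close>: by \<open>inverse_KL_unique\<close> below they determine the value at \<open>M\<close>, and by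
  \<open>inverse_KL_eqI\<close> this is the value of every assignment satisfying the conditions at all loopless
  matroids.
\<close>

definition inverse_KL :: "'a matroid \<Rightarrow> int poly" where
  "inverse_KL M =
     (THE q. \<exists>Q. (\<forall>F\<in>flats M. inverse_KL_conditions Q (restrict M F)) \<and> Q M = q)"


section \<open>The inverse Z-polynomial\<close>

definition Y_hat :: "'a matroid \<Rightarrow> int poly" where
  "Y_hat M = (\<Sum>F\<in>flats M. (-1) ^ rank_of M F * inverse_KL (restrict M F) *
                monom (mu (contract M F)) (rk (contract M F)))"

definition inverse_Z :: "'a matroid \<Rightarrow> int poly" where
  "inverse_Z M =
     (if loopless M then (-1) ^ rk M * Y_hat M
      else (-1) ^ rk (delete_loops M) * Y_hat (delete_loops M))"


section \<open>Well-definedness\<close>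

lemma is_matroidD:
  assumes "is_matroid M"
  shows "finite (ground M)" "\<And>I. I \<in> indep M \<Longrightarrow> I \<subseteq> ground M" "{} \<in> indep M"
    "\<And>I J. I \<in> indep M \<Longrightarrow> J \<subseteq> I \<Longrightarrow> J \<in> indep M"
    "\<And>I J. I \<in> indep M \<Longrightarrow> J \<in> indep M \<Longrightarrow> card I < card J \<Longrightarrow> \<exists>x\<in>J - I. insert x I \<in> indep M"
    "\<And>I. I \<in> indep M \<Longrightarrow> finite I" "finite (indep M)"
proof -
  show *: "finite (ground M)" "\<And>I. I \<in> indep M \<Longrightarrow> I \<subseteq> ground M"
    using assms unfolding is_matroid_def by auto
  show "{} \<in> indep M" "\<And>I J. I \<in> indep M \<Longrightarrow> J \<subseteq> I \<Longrightarrow> J \<in> indep M"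
    "\<And>I J. I \<in> indep M \<Longrightarrow> J \<in> indep M \<Longrightarrow> card I < card J \<Longrightarrow> \<exists>x\<in>J - I. insert x I \<in> indep M"
    using assms unfolding is_matroid_def by metis+
  show "\<And>I. I \<in> indep M \<Longrightarrow> finite I" using * finite_subset by blast
  have "indep M \<subseteq> Pow (ground M)" using * by auto
  thus "finite (indep M)" using * by (meson finite_Pow_iff finite_subset)
qed

lemma rank_of_ge:
  assumes "is_matroid M" "I \<in> indep M" "I \<subseteq> S"
  shows "card I \<le> rank_of M S"
  unfolding rank_of_def using assms is_matroidD(7)[OF assms(1)] by (intro Max_ge) auto

lemma rank_of_witness:
  assumes "is_matroid M"
  obtains I where "I \<in> indep M" "I \<subseteq> S" "card I = rank_of M S"
proof -
  have "rank_of M S \<in> card ` {I \<in> indep M. I \<subseteq> S}"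
    unfolding rank_of_def using is_matroidD(3,7)[OF assms] by (intro Max_in) auto
  thus ?thesis using that by auto
qed

lemma extend_indep:
  assumes M: "is_matroid M" and "B \<in> indep M" "B \<subseteq> S"
  obtains C where "C \<in> indep M" "B \<subseteq> C" "C \<subseteq> S" "card C = rank_of M S"
proof -
  have "\<exists>C\<in>indep M. B \<subseteq> C \<and> C \<subseteq> S \<and> card C = rank_of M S"
    using assms(2,3)
  proof (induction "rank_of M S - card B" arbitrary: B)
    case 0
    thus ?case using rank_of_ge[OF M] by (metis diff_is_0_eq' le_antisym order_refl diff_is_0_eq)
  next
    case (Suc m)
    obtain I where I: "I \<in> indep M" "I \<subseteq> S" "card I = rank_of M S"
      using rank_of_witness[OF M] .
    have "card B < card I" using Suc(2) I by linarith
    then obtain x where x: "x \<in> I - B" "insert x B \<in> indep M"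
      using is_matroidD(5)[OF M Suc(3) I(1)] by blast
    have "card (insert x B) = Suc (card B)"
      using x is_matroidD(6)[OF M Suc(3)] by simp
    hence "\<exists>C\<in>indep M. insert x B \<subseteq> C \<and> C \<subseteq> S \<and> card C = rank_of M S"
      using Suc(2,4) x I(2) by (intro Suc(1)) auto
    thus ?case by blast
  qed
  thus ?thesis using that by auto
qed

lemma ground_restrict [simp]: "ground (restrict M F) = F"
  and indep_restrict: "indep (restrict M F) = {I \<in> indep M. I \<subseteq> F}"
  by (auto simp: restrict_def)

lemma restrict_restrict: "G \<subseteq> F \<Longrightarrow> restrict (restrict M F) G = restrict M G"
  by (auto simp: restrict_def)

lemma rank_of_restrict: "G \<subseteq> F \<Longrightarrow> rank_of (restrict M F) G = rank_of M G"
  unfolding rank_of_def indep_restrict by (rule arg_cong[of _ _ Max]) auto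

lemma rk_restrict: "rk (restrict M F) = rank_of M F"
  by (simp add: rk_def rank_of_restrict)

lemma restrict_ground: "is_matroid M \<Longrightarrow> restrict M (ground M) = M"
  using is_matroidD(2)[of M] by (cases M) (auto simp: restrict_def)

lemma is_matroid_restrict:
  assumes M: "is_matroid M" and F: "F \<subseteq> ground M"
  shows "is_matroid (restrict M F)"
  unfolding is_matroid_def ground_restrict indep_restrict
proof (intro conjI ballI allI impI)
  show "finite F" using F is_matroidD(1)[OF M] finite_subset by blast
  show "{I \<in> indep M. I \<subseteq> F} \<subseteq> Pow F" by blast
  show "{} \<in> {I \<in> indep M. I \<subseteq> F}" using is_matroidD(3)[OF M] by simp
next
  fix I J assume "I \<in> {I \<in> indep M. I \<subseteq> F}" "J \<subseteq> I"
  thus "J \<in> {I \<in> indep M. I \<subseteq> F}" using is_matroidD(4)[OF M, of I J] by auto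
next
  fix I J assume "I \<in> {I \<in> indep M. I \<subseteq> F}" "J \<in> {I \<in> indep M. I \<subseteq> F}" "card I < card J"
  thus "\<exists>x\<in>J - I. insert x I \<in> {I \<in> indep M. I \<subseteq> F}"
    using is_matroidD(5)[OF M, of I J] by auto
qed

lemma loopless_restrict: "loopless M \<Longrightarrow> F \<subseteq> ground M \<Longrightarrow> loopless (restrict M F)"
  by (auto simp: loopless_def loops_def indep_restrict)

lemma flats_subset: "F \<in> flats M \<Longrightarrow> F \<subseteq> ground M"
  by (simp add: flats_def)

lemma ground_in_flats: "ground M \<in> flats M"
  by (simp add: flats_def)

lemma flats_restrict_subset:
  assumes M: "is_matroid M" and F: "F \<in> flats M" and G: "G \<in> flats (restrict M F)"
  shows "G \<in> flats M"
proof -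
  have GF: "G \<subseteq> F" using flats_subset[OF G] by simp
  have FM: "F \<subseteq> ground M" using flats_subset[OF F] .
  have "rank_of M G < rank_of M (insert x G)" if x: "x \<in> ground M - G" for x
  proof (cases "x \<in> F")
    case True
    with x G GF show ?thesis
      by (auto simp: flats_def rank_of_restrict)
  next
    case False
    obtain B where B: "B \<in> indep M" "B \<subseteq> G" "card B = rank_of M G"
      using rank_of_witness[OF M] .
    obtain C where C: "C \<in> indep M" "B \<subseteq> C" "C \<subseteq> F" "card C = rank_of M F"
      using extend_indep[OF M B(1)] B(2) GF by (metis subset_trans)
    obtain I where I: "I \<in> indep M" "I \<subseteq> insert x F" "card I = rank_of M (insert x F)"
      using rank_of_witness[OF M] .
    have "card C < card I" using F x False C I by (auto simp: flats_def)
    then obtain y where y: "y \<in> I - C" "insert y C \<in> indep M"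
      using is_matroidD(5)[OF M C(1) I(1)] by blast
    have "y \<notin> F"
    proof
      assume "y \<in> F"
      hence "card (insert y C) \<le> rank_of M F" using rank_of_ge[OF M y(2)] C by auto
      thus False using y(1) C(4) is_matroidD(6)[OF M C(1)] by simp
    qed
    hence "y = x" using y I by auto
    hence xB: "insert x B \<in> indep M" using is_matroidD(4)[OF M y(2), of "insert x B"] C by auto
    have "x \<notin> B" using False B GF by auto
    hence "card (insert x B) = Suc (card B)"
      using is_matroidD(6)[OF M B(1)] by simp
    moreover have "card (insert x B) \<le> rank_of M (insert x G)"
      using rank_of_ge[OF M xB] B by auto
    ultimately show ?thesis using B by simp
  qed
  thus ?thesis using GF FM by (auto simp: flats_def)
qed

lemma reverse_at_contract_ground:
  assumes M: "is_matroid M"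
  shows "reverse_at (rk (contract M (ground M))) (char_poly (contract M (ground M))) = 1"
proof -
  define N where "N = contract M (ground M)"
  obtain C where C: "C \<in> indep M" "card C = rank_of M (ground M)"
    using rank_of_witness[OF M] by metis
  have "I = C" if "I \<in> indep M" "C \<subseteq> I" for I
    using that C rank_of_ge[OF M that(1) is_matroidD(2)[OF M that(1)]] is_matroidD(6)[OF M that(1)]
    by (metis card_seteq)
  hence "C \<in> bases (restrict M (ground M))"
    using C unfolding restrict_ground[OF M] bases_def by auto
  hence N: "N = Matroid {} {{}}"
    using C by (auto simp: N_def contract_def)
  have fl: "flats (Matroid {} {{}} :: 'a matroid) = {{}}" by (auto simp: flats_def)
  have r: "restrict (Matroid {} {{}}) {} = (Matroid {} {{}} :: 'a matroid)"
    by (auto simp: restrict_def)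
  have c: "contract (Matroid {} {{}}) {} = (Matroid {} {{}} :: 'a matroid)"
    by (auto simp: contract_def r bases_def)
  have rk: "rk (Matroid {} {{}} :: 'a matroid) = 0"
    by (simp add: rk_def rank_of_def)
  have mu: "mu (Matroid {} {{}} :: 'a matroid) = 1"
    by (simp add: mu_def mobius.simps)
  show ?thesis
    unfolding N_def[symmetric] N by (simp add: char_poly_def fl r c rk mu reverse_at_def)
qed

lemma coeff_reverse_at: "coeff (reverse_at r p) i = (if i \<le> r then coeff p (r - i) else 0)"
proof -
  have "coeff (reverse_at r p) i = (\<Sum>j\<le>r. if r - j = i then coeff p j else 0)"
    by (simp add: reverse_at_def coeff_sum)
  also have "\<dots> = (\<Sum>j\<le>r. if j = r - i then (if i \<le> r then coeff p j else 0) else 0)"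
    by (intro sum.cong refl) auto
  finally show ?thesis by simp
qed

lemma reverse_at_eq_imp_eq:
  assumes eq: "reverse_at r p - reverse_at r q = p - q"
    and "2 * degree p < r" "2 * degree q < r"
  shows "p = q"
proof (rule poly_eqI)
  fix i
  show "coeff p i = coeff q i"
  proof (cases "2 * i < r")
    case True
    hence "coeff p (r - i) = 0" "coeff q (r - i) = 0"
      using assms(2,3) by (auto intro!: coeff_eq_0)
    hence "coeff p i - coeff q i = 0"
      using arg_cong[OF eq, of "\<lambda>p. coeff p i"] by (simp add: coeff_reverse_at split: if_splits)
    thus ?thesis by simp
  next
    case False
    thus ?thesis using assms(2,3) by (simp add: coeff_eq_0)
  qed
qed

lemma inverse_KL_unique:
  assumes "is_matroid M"
    and "\<forall>F\<in>flats M. inverse_KL_conditions Q (restrict M F)"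
    and "\<forall>F\<in>flats M. inverse_KL_conditions Q' (restrict M F)"
  shows "Q M = Q' M"
  using assms
proof (induction "card (ground M)" arbitrary: M rule: less_induct)
  case less
  note M = less(2)
  let ?r = "rk M"
  let ?\<chi> = "\<lambda>F. reverse_at (rk (contract M F)) (char_poly (contract M F))"
  let ?g = "\<lambda>Q F. (-1) ^ rank_of M F * Q (restrict M F) * ?\<chi> F"
  have fin: "finite (flats M)"
    using flats_subset is_matroidD(1)[OF M] by (metis PowI finite_Pow_iff finite_subset subsetI)
  have IH: "Q (restrict M F) = Q' (restrict M F)" if F: "F \<in> flats M - {ground M}" for F
  proof (rule less(1))
    have sub: "F \<subseteq> ground M" using F flats_subset by blast
    show "card (ground (restrict M F)) < card (ground M)"
      using F sub is_matroidD(1)[OF M] by (auto intro!: psubset_card_mono)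
    show "is_matroid (restrict M F)" using is_matroid_restrict[OF M sub] .
    have "G \<in> flats M \<and> restrict (restrict M F) G = restrict M G" if "G \<in> flats (restrict M F)" for G
      using that F flats_restrict_subset[OF M] flats_subset[OF that] by (auto simp: restrict_restrict)
    thus "\<forall>G\<in>flats (restrict M F). inverse_KL_conditions Q (restrict (restrict M F) G)"
      "\<forall>G\<in>flats (restrict M F). inverse_KL_conditions Q' (restrict (restrict M F) G)"
      using less(3,4) by auto
  qed
  have cond: "inverse_KL_conditions Q M" "inverse_KL_conditions Q' M"
    using less(3,4) ground_in_flats restrict_ground[OF M] by metis+
  show ?case
  proof (cases "?r = 0")
    case True
    thus ?thesis using cond by (simp add: inverse_KL_conditions_def)
  next
    case False
    have split: "(-1) ^ ?r * reverse_at ?r (P M) = (-1) ^ ?r * P M + sum (?g P) (flats M - {ground M})"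
      if "inverse_KL_conditions P M" for P
    proof -
      have "(-1) ^ ?r * reverse_at ?r (P M) = sum (?g P) (flats M)"
        using that by (simp add: inverse_KL_conditions_def)
      also have "\<dots> = ?g P (ground M) + sum (?g P) (flats M - {ground M})"
        by (rule sum.remove[OF fin ground_in_flats])
      finally show ?thesis
        by (simp add: reverse_at_contract_ground[OF M] restrict_ground[OF M] flip: rk_def)
    qed
    have "sum (?g Q) (flats M - {ground M}) = sum (?g Q') (flats M - {ground M})"
      using IH by (intro sum.cong) auto
    hence "(-1) ^ ?r * (reverse_at ?r (Q M) - reverse_at ?r (Q' M)) = (-1) ^ ?r * (Q M - Q' M)"
      using split[OF cond(1)] split[OF cond(2)] by (simp add: algebra_simps)
    hence "reverse_at ?r (Q M) - reverse_at ?r (Q' M) = Q M - Q' M"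
      by simp
    moreover have "2 * degree (Q M) < ?r" "2 * degree (Q' M) < ?r"
      using cond False by (auto simp: inverse_KL_conditions_def)
    ultimately show ?thesis by (rule reverse_at_eq_imp_eq)
  qed
qed

lemma inverse_KL_eqI_local:
  assumes "is_matroid M" "\<forall>F\<in>flats M. inverse_KL_conditions Q (restrict M F)"
  shows "inverse_KL M = Q M"
  unfolding inverse_KL_def
proof (rule the_equality)
  show "\<exists>Q'. (\<forall>F\<in>flats M. inverse_KL_conditions Q' (restrict M F)) \<and> Q' M = Q M"
    using assms(2) by blast
  show "q = Q M"
    if "\<exists>Q'. (\<forall>F\<in>flats M. inverse_KL_conditions Q' (restrict M F)) \<and> Q' M = q" for q
    using that inverse_KL_unique[OF assms(1) _ assms(2)] by metis
qed

theorem inverse_KL_eqI: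
  assumes "\<And>N :: 'a matroid. is_matroid N \<Longrightarrow> loopless N \<Longrightarrow> inverse_KL_conditions Q N"
    and M: "is_matroid M" "loopless M"
  shows "inverse_KL M = Q M"
proof (rule inverse_KL_eqI_local[OF M(1)], rule ballI)
  fix F assume "F \<in> flats M"
  hence "F \<subseteq> ground M" by (rule flats_subset)
  thus "inverse_KL_conditions Q (restrict M F)"
    by (intro assms(1) is_matroid_restrict loopless_restrict M)
qed

lemma indep_uniform:
  assumes "k \<le> n"
  shows "indep (uniform k n) = {I. I \<subseteq> {1..n} \<and> card I \<le> k}"
proof -
  have "\<exists>B\<subseteq>{1..n}. card B = k \<and> I \<subseteq> B" if I: "I \<subseteq> {1..n}" "card I \<le> k" for I
    using exists_subset_between[of I k "{1..n}"] I assms by auto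
  moreover have "card I \<le> card B" if "B \<subseteq> {1..n}" "I \<subseteq> B" for I B
    using that finite_subset[of B "{1..n}"] by (auto intro: card_mono)
  ultimately show ?thesis
    by (auto simp: uniform_def matroid_of_bases_def)
qed

lemma is_matroid_uniform:
  assumes "k \<le> n"
  shows "is_matroid (uniform k n)"
proof -
  have "\<exists>x\<in>J - I. insert x I \<subseteq> {1..n} \<and> card (insert x I) \<le> k"
    if "I \<subseteq> {1..n}" "J \<subseteq> {1..n}" "card J \<le> k" "card I < card J" for I J :: "nat set"
  proof -
    have fin: "finite I" "finite J" using that finite_subset by blast+
    hence "\<not> J \<subseteq> I" using that card_mono by (metis not_le)
    then obtain x where "x \<in> J - I" by blast
    thus ?thesis using that fin by (intro bexI[of _ x]) auto
  qed
  moreover have "card J \<le> k" if "J \<subseteq> I" "I \<subseteq> {1..n}" "card I \<le> k" for I J :: "nat set"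
    using that card_mono[of I J] finite_subset[of I "{1..n}"] by auto
  moreover have "ground (uniform k n) = {1..n}"
    by (simp add: uniform_def matroid_of_bases_def)
  ultimately show ?thesis
    unfolding is_matroid_def indep_uniform[OF assms] by auto
qed

lemma bases_uniform:
  assumes "k \<le> n"
  shows "bases (uniform k n) = {B. B \<subseteq> {1..n} \<and> card B = k}"
proof (intro equalityI subsetI)
  fix B assume "B \<in> bases (uniform k n)"
  hence B: "B \<subseteq> {1..n}" "card B \<le> k"
    "\<And>I. I \<subseteq> {1..n} \<Longrightarrow> card I \<le> k \<Longrightarrow> B \<subseteq> I \<Longrightarrow> I = B"
    by (auto simp: bases_def indep_uniform[OF assms])
  obtain C where "B \<subseteq> C" "C \<subseteq> {1..n}" "card C = k"
    using exists_subset_between[of B k "{1..n}"] B assms by auto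
  thus "B \<in> {B. B \<subseteq> {1..n} \<and> card B = k}" using B(3)[of C] by auto
next
  fix B assume "B \<in> {B. B \<subseteq> {1..n} \<and> card B = k}"
  thus "B \<in> bases (uniform k n)"
    by (auto simp: bases_def indep_uniform[OF assms])
      (metis card_seteq finite_atLeastAtMost finite_subset subsetD)+
qed

end

theory Submission
  imports Defs
begin

text \<open>A proper flat of a uniform matroid is independent, so the restriction to it is free, with
  inverse Kazhdan--Lusztig polynomial 1, and its contraction is again uniform.  With
  \<open>a i = (n choose i) * (n - i - 1 choose n - k)\<close> for \<open>i < k\<close> and \<open>a i = 0\<close> for \<open>i \<ge> k\<close>, the
  defining recursion therefore reads \<open>t^k Q(1/t) - Q(t) = (\<Sum>m. (a (k - m) - a m) t^m)\<close>, and the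
  degree bound on \<open>Q\<close> forces its coefficient at \<open>t^m\<close> to be \<open>a m - a (k - m)\<close> for \<open>2 m < k\<close>.
  In \<open>Y = (\<Sum>i<k. a i t^(k-i)) + Q\<close> the negative part of \<open>Q\<close> cancels the terms with \<open>2 i > k\<close>.\<close>

section \<open>Uniform matroids, their flats and minors\<close>

text \<open>Minors of \<open>uniform k n\<close> live on other sets than an initial interval, so the
  ground set is arbitrary. Prescribing the independent sets instead of the bases gives a matroid for
  every finite \<open>E\<close> and every \<open>k\<close>.\<close>

definition uniform_on :: "nat \<Rightarrow> 'a set \<Rightarrow> 'a matroid" where
  "uniform_on k E = Matroid E {I. I \<subseteq> E \<and> card I \<le> k}"

lemma ground_uniform_on [simp]: "ground (uniform_on k E) = E"
  and indep_uniform_on: "indep (uniform_on k E) = {I. I \<subseteq> E \<and> card I \<le> k}"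
  by (simp_all add: uniform_on_def)

lemma uniform_eq_uniform_on: "k \<le> n \<Longrightarrow> uniform k n = uniform_on k {1..n}"
  using indep_uniform[of k n]
  by (cases "uniform k n") (simp add: uniform_on_def uniform_def matroid_of_bases_def)

lemma rank_of_uniform_on:
  assumes "finite E" "F \<subseteq> E"
  shows "rank_of (uniform_on k E) F = min k (card F)"
  unfolding rank_of_def
proof (rule Max_eqI)
  have fF: "finite F" using assms finite_subset by blast
  have "{I \<in> indep (uniform_on k E). I \<subseteq> F} \<subseteq> Pow F" by auto
  thus "finite (card ` {I \<in> indep (uniform_on k E). I \<subseteq> F})"
    using fF by (meson finite_Pow_iff finite_imageI finite_subset)
  show "y \<le> min k (card F)" if "y \<in> card ` {I \<in> indep (uniform_on k E). I \<subseteq> F}" for y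
    using that fF by (auto simp: indep_uniform_on intro: card_mono)
  obtain I where "I \<subseteq> F" "card I = min k (card F)"
    using obtain_subset_with_card_n[of "min k (card F)" F] by auto
  thus "min k (card F) \<in> card ` {I \<in> indep (uniform_on k E). I \<subseteq> F}"
    using assms(2) by (intro image_eqI[of _ _ I]) (auto simp: indep_uniform_on)
qed

lemma rk_uniform_on: "finite E \<Longrightarrow> k \<le> card E \<Longrightarrow> rk (uniform_on k E) = k"
  by (simp add: rk_def rank_of_uniform_on)

lemma is_matroid_uniform_on:
  assumes "finite E"
  shows "is_matroid (uniform_on k E)"
proof -
  have "\<exists>x\<in>J - I. insert x I \<subseteq> E \<and> card (insert x I) \<le> k"
    if "I \<subseteq> E" "J \<subseteq> E" "card J \<le> k" "card I < card J" for I J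
  proof -
    have fin: "finite I" "finite J" using that assms finite_subset by blast+
    hence "\<not> J \<subseteq> I" using that card_mono by (metis not_le)
    then obtain x where "x \<in> J - I" by blast
    thus ?thesis using that fin by (intro bexI[of _ x]) auto
  qed
  moreover have "card J \<le> k" if "J \<subseteq> I" "I \<subseteq> E" "card I \<le> k" for I J
    using that card_mono[of I J] finite_subset[of I E] assms by auto
  ultimately show ?thesis
    using assms unfolding is_matroid_def indep_uniform_on by auto
qed

lemma loopless_uniform_on: "k > 0 \<Longrightarrow> loopless (uniform_on k E)"
  by (auto simp: loopless_def loops_def indep_uniform_on)

lemma flats_uniform_on:
  assumes "finite E" "k \<le> card E"
  shows "flats (uniform_on k E) = insert E {F. F \<subseteq> E \<and> card F < k}"
proof (intro equalityI subsetI)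
  fix F assume F: "F \<in> flats (uniform_on k E)"
  hence FE: "F \<subseteq> E" using flats_subset by fastforce
  show "F \<in> insert E {F. F \<subseteq> E \<and> card F < k}"
  proof (cases "F = E")
    case False
    then obtain x where "x \<in> E - F" using FE by blast
    thus ?thesis using F FE assms(1) by (force simp: flats_def rank_of_uniform_on)
  qed simp
next
  fix F assume F: "F \<in> insert E {F. F \<subseteq> E \<and> card F < k}"
  hence FE: "F \<subseteq> E" by auto
  hence "finite F" using assms(1) finite_subset by blast
  thus "F \<in> flats (uniform_on k E)"
    using F FE assms(1) by (auto simp: flats_def rank_of_uniform_on)
qed

lemma restrict_uniform_on:
  assumes "finite E" "F \<subseteq> E" "card F \<le> k"
  shows "restrict (uniform_on k E) F = uniform_on (card F) F"
proof -
  have "card I \<le> card F \<and> card I \<le> k \<and> I \<subseteq> E" if "I \<subseteq> F" for I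
    using that assms finite_subset[of F E] card_mono[of F I] by auto
  hence "(I \<subseteq> E \<and> card I \<le> k) \<and> I \<subseteq> F \<longleftrightarrow> I \<subseteq> F \<and> card I \<le> card F" for I
    by blast
  thus ?thesis unfolding restrict_def indep_uniform_on by (simp add: uniform_on_def)
qed

text \<open>As \<open>F\<close> is independent, it is the only basis of the restriction to
  \<open>F\<close>, and independence of \<open>I\<close> in the contraction reduces to counting
  \<open>I \<union> F\<close>.\<close>

lemma contract_uniform_on:
  assumes "finite E" "F \<subseteq> E" "card F \<le> k"
  shows "contract (uniform_on k E) F = uniform_on (k - card F) (E - F)"
proof -
  have fF: "finite F" using assms finite_subset by blast
  have B: "bases (uniform_on (card F) F) = {F}"
    using fF card_mono[OF fF] by (auto simp: bases_def indep_uniform_on)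
  have "card (I \<union> F) = card I + card F" if "I \<subseteq> E - F" for I
    using that assms fF finite_subset[of I E] by (intro card_Un_disjoint) auto
  hence "I \<subseteq> E - F \<and> I \<union> F \<in> indep (uniform_on k E) \<longleftrightarrow> I \<subseteq> E - F \<and> card I \<le> k - card F" for I
    using assms by (auto simp: indep_uniform_on)
  hence "{I. I \<subseteq> E - F \<and> I \<union> F \<in> indep (uniform_on k E)} = {I. I \<subseteq> E - F \<and> card I \<le> k - card F}"
    by (intro Collect_cong)
  moreover have "contract (uniform_on k E) F =
      Matroid (E - F) {I. I \<subseteq> E - F \<and> I \<union> F \<in> indep (uniform_on k E)}"
    unfolding contract_def restrict_uniform_on[OF assms] B by simp
  ultimately show ?thesis
    by (simp only: uniform_on_def[of "k - card F"])
qed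

text \<open>The top flat is treated separately: for \<open>k < card E\<close> it is dependent, and
  \<open>contract_uniform_on\<close> does not apply.\<close>

lemma contract_uniform_on_ground:
  assumes "finite E" "k \<le> card E"
  shows "contract (uniform_on k E) E = uniform_on 0 {}"
proof -
  obtain B where B: "B \<subseteq> E" "card B = k"
    using obtain_subset_with_card_n[OF assms(2)] by metis
  have "I = B" if "I \<subseteq> E" "card I \<le> k" "B \<subseteq> I" for I
    using that B assms(1) card_seteq[of I B] finite_subset[of I E] by auto
  hence "B \<in> bases (uniform_on k E)"
    using B by (auto simp: bases_def indep_uniform_on)
  moreover have "restrict (uniform_on k E) E = uniform_on k E"
    using restrict_ground[OF is_matroid_uniform_on[OF assms(1)]] by simp
  ultimately show ?thesis
    using B by (auto simp: contract_def uniform_on_def)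
qed

section \<open>Sums over flats\<close>

lemma sum_subsets_card_less:
  fixes g :: "nat \<Rightarrow> 'b::comm_ring_1"
  assumes "finite E"
  shows "(\<Sum>F | F \<subseteq> E \<and> card F < k. g (card F)) = (\<Sum>i<k. of_nat (card E choose i) * g i)"
proof -
  have fin: "finite {F. F \<subseteq> E \<and> card F < k}" using assms by simp
  have "(\<Sum>F | F \<subseteq> E \<and> card F < k. g (card F)) =
      (\<Sum>i<k. \<Sum>F | F \<in> {F. F \<subseteq> E \<and> card F < k} \<and> card F = i. g (card F))"
    by (rule sum.group[symmetric]) (use fin in auto)
  also have "\<dots> = (\<Sum>i<k. of_nat (card E choose i) * g i)"
  proof (intro sum.cong refl)
    fix i assume "i \<in> {..<k}"
    hence eq: "{F. F \<in> {F. F \<subseteq> E \<and> card F < k} \<and> card F = i} = {F. F \<subseteq> E \<and> card F = i}"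
      by auto
    have "(\<Sum>F | F \<subseteq> E \<and> card F = i. g (card F)) = (\<Sum>F | F \<subseteq> E \<and> card F = i. g i)"
      by (intro sum.cong) auto
    thus "(\<Sum>F | F \<in> {F. F \<subseteq> E \<and> card F < k} \<and> card F = i. g (card F)) =
        of_nat (card E choose i) * g i"
      using n_subsets[OF assms, of i] by (simp only: eq) simp
  qed
  finally show ?thesis .
qed

text \<open>The characteristic polynomial, the recursion for Q and \<open>Y_hat\<close> are all sums
  over flats whose summand at a proper flat depends on its cardinality only; the top flat has to
  stay apart.\<close>

lemma sum_flats_uniform_on:
  fixes f :: "'a set \<Rightarrow> 'b::comm_ring_1"
  assumes "finite E" "k \<le> card E"
    and "\<And>F. F \<subseteq> E \<Longrightarrow> card F < k \<Longrightarrow> f F = g (card F)"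
  shows "sum f (flats (uniform_on k E)) = (\<Sum>i<k. of_nat (card E choose i) * g i) + f E"
proof -
  have "sum f (flats (uniform_on k E)) = f E + (\<Sum>F | F \<subseteq> E \<and> card F < k. f F)"
    unfolding flats_uniform_on[OF assms(1,2)] using assms(1,2) by (subst sum.insert) auto
  also have "(\<Sum>F | F \<subseteq> E \<and> card F < k. f F) = (\<Sum>F | F \<subseteq> E \<and> card F < k. g (card F))"
    using assms(3) by (intro sum.cong) auto
  finally show ?thesis by (simp add: sum_subsets_card_less[OF assms(1)])
qed

section \<open>Moebius values\<close>

text \<open>By Pascal's rule the partial alternating sums of a binomial row telescope.\<close>

lemma alternating_choose_sum:
  "(\<Sum>i<Suc m. of_nat (Suc n choose i) * (-1) ^ i) = (-1) ^ m * (of_nat (n choose m) :: 'a::comm_ring_1)"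
proof (induction m)
  case (Suc m)
  show ?case by (subst sum.lessThan_Suc, subst Suc) (simp add: algebra_simps)
qed simp

text \<open>The interval below \<open>X\<close> is Boolean, whatever else \<open>L\<close> contains.
  This is how it applies to the proper flats of a uniform matroid.\<close>

lemma mobius_all_subsets:
  assumes "finite X" "Pow X \<subseteq> L"
  shows "mobius L {} X = (-1) ^ card X"
  using assms
proof (induction X rule: finite_psubset_induct)
  case (psubset X)
  show ?case
  proof (cases "X = {}")
    case False
    then obtain m where m: "card X = Suc m" using psubset(1) by (metis card_0_eq not0_implies_Suc)
    have eq: "{Z \<in> L. {} \<subseteq> Z \<and> Z \<subset> X} = {Z. Z \<subseteq> X \<and> card Z < card X}"
      using psubset(1,3) by (auto intro: psubset_card_mono)
    have "mobius L {} X = - (\<Sum>Z | Z \<subseteq> X \<and> card Z < card X. mobius L {} Z)"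
      using False psubset(1) unfolding eq[symmetric] by (subst mobius.simps) auto
    also have "(\<Sum>Z | Z \<subseteq> X \<and> card Z < card X. mobius L {} Z) =
        (\<Sum>Z | Z \<subseteq> X \<and> card Z < card X. (-1) ^ card Z)"
      by (intro sum.cong refl psubset(2)) (use psubset(3) in auto)
    also have "\<dots> = (\<Sum>i<card X. of_nat (card X choose i) * (-1) ^ i)"
      by (rule sum_subsets_card_less[OF psubset(1)])
    \<comment> \<open>Here the truncation drops only the last term of the full alternating row,
      whose sum is 0.\<close>
    also have "\<dots> = (-1) ^ m"
      unfolding m by (subst alternating_choose_sum) simp
    finally show ?thesis by (simp add: m)
  qed (simp add: mobius.simps)
qed

text \<open>Below the top, the lattice of flats is a Boolean lattice cut off at cardinality
  \<open>k\<close>, so the value is minus a truncated alternating sum.\<close>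

lemma mu_uniform_on:
  assumes "finite E" "0 < k" "k \<le> card E"
  shows "mu (uniform_on k E) = (-1) ^ k * int ((card E - 1) choose (k - 1))"
proof -
  obtain m n where mn: "k = Suc m" "card E = Suc n"
    using assms by (metis Suc_le_D Suc_pred)
  let ?L = "flats (uniform_on k E)"
  have eq: "{Z \<in> ?L. {} \<subseteq> Z \<and> Z \<subset> E} = {Z. Z \<subseteq> E \<and> card Z < k}"
    using assms by (auto simp: flats_uniform_on)
  have sub: "Pow Z \<subseteq> ?L" if "Z \<subseteq> E" "card Z < k" for Z
  proof
    fix W assume "W \<in> Pow Z"
    hence "W \<subseteq> E" "card W \<le> card Z"
      using that assms(1) finite_subset[of Z E] by (auto intro: card_mono)
    thus "W \<in> ?L" using that assms by (simp add: flats_uniform_on)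
  qed
  have "mu (uniform_on k E) = - (\<Sum>Z | Z \<subseteq> E \<and> card Z < k. mobius ?L {} Z)"
    using assms unfolding mu_def eq[symmetric] by (subst mobius.simps) auto
  also have "(\<Sum>Z | Z \<subseteq> E \<and> card Z < k. mobius ?L {} Z) =
      (\<Sum>Z | Z \<subseteq> E \<and> card Z < k. (-1) ^ card Z)"
    using sub assms(1) by (intro sum.cong refl mobius_all_subsets) (auto intro: finite_subset)
  also have "\<dots> = (\<Sum>i<k. of_nat (card E choose i) * (-1) ^ i)"
    by (rule sum_subsets_card_less[OF assms(1)])
  also have "\<dots> = (-1) ^ m * int (n choose m)"
    unfolding mn by (rule alternating_choose_sum)
  finally show ?thesis by (simp add: mn)
qed

lemma mu_uniform_on_0: "mu (uniform_on 0 {}) = 1"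
  by (simp add: mu_def mobius.simps)

lemma mu_free:
  assumes "finite F"
  shows "mu (uniform_on (card F) F) = (-1) ^ card F"
proof (cases "card F = 0")
  case True
  thus ?thesis using assms by (simp add: mu_uniform_on_0)
next
  case False
  thus ?thesis using mu_uniform_on[OF assms, of "card F"] by simp
qed

section \<open>Coefficients in the defining recursion\<close>

text \<open>For \<open>0 < k \<le> n\<close> this is the coefficient of t^m in t^k \<chi>(1/t) for
  the uniform matroid of rank \<open>k\<close> on \<open>n\<close> elements: the sum of the Moebius
  values of its flats of rank \<open>m\<close>. The case \<open>m = k\<close> is the top
  flat.\<close>

definition rev_char_coeff :: "nat \<Rightarrow> nat \<Rightarrow> nat \<Rightarrow> int" where
  "rev_char_coeff k n m =
     (if m < k then (-1) ^ m * int (n choose m)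
      else if m = k then (-1) ^ k * int ((n - 1) choose (k - 1)) else 0)"

lemma coeff_reverse_char_poly_uniform_on:
  assumes "finite E" "0 < k" "k \<le> card E"
  shows "coeff (reverse_at k (char_poly (uniform_on k E))) m = rev_char_coeff k (card E) m"
proof -
  let ?n = "card E"
  have "char_poly (uniform_on k E) =
      (\<Sum>i<k. of_nat (?n choose i) * monom ((-1) ^ i) (k - i)) +
      monom (mu (restrict (uniform_on k E) E)) (rk (contract (uniform_on k E) E))"
    unfolding char_poly_def
  proof (rule sum_flats_uniform_on[OF assms(1,3)])
    fix F assume F: "F \<subseteq> E" "card F < k"
    have "finite F" using F assms finite_subset by blast
    moreover have "k - card F \<le> card (E - F)"
      using F assms \<open>finite F\<close> by (simp add: card_Diff_subset)
    ultimately show "monom (mu (restrict (uniform_on k E) F)) (rk (contract (uniform_on k E) F)) =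
        monom ((-1) ^ card F) (k - card F)"
      using F assms by (simp add: restrict_uniform_on contract_uniform_on mu_free rk_uniform_on)
  qed
  moreover have "restrict (uniform_on k E) E = uniform_on k E"
    using restrict_ground[OF is_matroid_uniform_on[OF assms(1)]] by simp
  moreover have "rk (contract (uniform_on k E) E) = 0"
    using assms by (simp add: contract_uniform_on_ground rk_uniform_on)
  ultimately have C: "char_poly (uniform_on k E) =
      (\<Sum>i<k. of_nat (?n choose i) * monom ((-1) ^ i) (k - i)) + monom (mu (uniform_on k E)) 0"
    by simp
  have "coeff (char_poly (uniform_on k E)) (k - m) = rev_char_coeff k ?n m" if "m \<le> k"
  proof -
    have "coeff (char_poly (uniform_on k E)) (k - m) =
        (\<Sum>i<k. if i = m then (-1) ^ m * int (?n choose m) else 0) +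
        (if m = k then mu (uniform_on k E) else 0)"
      unfolding C coeff_add coeff_sum using that
      by (intro arg_cong2[of _ _ _ _ "(+)"] sum.cong) (auto simp: of_nat_poly)
    thus ?thesis using that mu_uniform_on[OF assms] by (simp add: rev_char_coeff_def)
  qed
  thus ?thesis by (cases "m \<le> k") (simp_all add: coeff_reverse_at rev_char_coeff_def)
qed

text \<open>Without the guard, truncated subtraction would give the value 1 instead of 0 at
  \<open>i = k = n\<close>.\<close>

definition Y_coeff :: "nat \<Rightarrow> nat \<Rightarrow> nat \<Rightarrow> int" where
  "Y_coeff k n i = (if i < k then int ((n choose i) * ((n - i - 1) choose (n - k))) else 0)"

text \<open>In this form the second factor is, up to sign, the Moebius value of the contraction by
  an \<open>i\<close>-element flat, which is uniform of rank \<open>k - i\<close> on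
  \<open>n - i\<close> elements.\<close>

lemma Y_coeff_altdef:
  assumes "i < k" "k \<le> n"
  shows "Y_coeff k n i = int (n choose i) * int ((n - i - 1) choose (k - i - 1))"
proof -
  have "(n - i - 1) - (k - i - 1) = n - k" using assms by simp
  thus ?thesis
    using assms binomial_symmetric[of "k - i - 1" "n - i - 1"] by (simp add: Y_coeff_def)
qed

text \<open>The indices \<open>i < k - m\<close> contribute a truncated alternating binomial sum, the index \<open>i = k - m\<close>
  the leading coefficient of the reversed characteristic polynomial.\<close>

lemma sum_rev_char_coeff:
  assumes "k \<le> n" "m \<le> k"
  shows "(\<Sum>i<k. int (n choose i) * ((-1) ^ i * rev_char_coeff (k - i) (n - i) m)) =
    (-1) ^ k * (Y_coeff k n (k - m) - Y_coeff k n m)"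
proof -
  let ?f = "\<lambda>i. int (n choose i) * ((-1) ^ i * rev_char_coeff (k - i) (n - i) m)"
  have "sum ?f {..<k} = sum ?f {..<k - m} + sum ?f {k - m..<k}"
    by (simp add: ivl_disj_un sum.atLeastLessThan_concat flip: atLeast0LessThan)
  also have "sum ?f {..<k - m} = - ((-1) ^ k * Y_coeff k n m)"
  \<comment> \<open>For \<open>m = k\<close> the range is empty, and the guard in
    \<open>Y_coeff\<close> makes the right side 0.\<close>
  proof (cases "m < k")
    case True
    then obtain j where j: "k - m = Suc j" by (metis Suc_diff_Suc)
    obtain l where l: "n - m = Suc l" using True assms by (metis Suc_diff_Suc less_le_trans)
    have "sum ?f {..<k - m} =
        (\<Sum>i<k - m. (-1) ^ m * int (n choose m) * (of_nat ((n - m) choose i) * (-1) ^ i))"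
    proof (intro sum.cong refl)
      fix i assume i: "i \<in> {..<k - m}"
      \<comment> \<open>Both sides count the pairs of disjoint subsets of sizes \<open>i\<close> and
        \<open>m\<close> in an \<open>n\<close>-set. Exchanging the roles of \<open>i\<close> and
        \<open>m\<close> pulls out a factor free of \<open>i\<close>.\<close>
      hence "(n choose i) * ((n - i) choose m) = (n choose m) * ((n - m) choose i)"
        using assms choose_mult_lemma[of m "n - m - i" i] choose_mult_lemma[of i "n - m - i" m]
          binomial_symmetric[of m "m + i"]
        by (simp add: add.commute)
      hence "int (n choose i) * int ((n - i) choose m) = int (n choose m) * int ((n - m) choose i)"
        by (metis of_nat_mult)
      moreover have "m < k - i" using i by simp
      ultimately show "?f i = (-1) ^ m * int (n choose m) * (of_nat ((n - m) choose i) * (-1) ^ i)"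
        by (simp add: rev_char_coeff_def algebra_simps)
    qed
    also have "\<dots> = (-1) ^ m * int (n choose m) * ((-1) ^ j * int (l choose j))"
      unfolding j l sum_distrib_left[symmetric] by (subst alternating_choose_sum) simp
    also have "int (n choose m) * int (l choose j) = Y_coeff k n m"
    proof -
      have "n - m - 1 = l" "k - m - 1 = j" using j l by auto
      thus ?thesis using Y_coeff_altdef[OF True assms(1)] by simp
    qed
    hence "(-1) ^ m * int (n choose m) * ((-1) ^ j * int (l choose j)) = (-1) ^ (m + j) * Y_coeff k n m"
      by (simp add: power_add algebra_simps)
    also have "k = Suc (m + j)" using j by simp
    hence "(-1) ^ (m + j) * Y_coeff k n m = - ((-1) ^ k * Y_coeff k n m)"
      by simp
    finally show ?thesis .
  qed (simp add: Y_coeff_def)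
  also have "sum ?f {k - m..<k} = (-1) ^ k * Y_coeff k n (k - m)"
  \<comment> \<open>For \<open>m = 0\<close> the range is empty and the guard gives
    \<open>Y_coeff k n k = 0\<close>. Otherwise the indices beyond \<open>k - m\<close> drop out,
    because there \<open>m\<close> exceeds the rank \<open>k - i\<close> of the contraction.\<close>
  proof (cases "m = 0")
    case False
    have "sum ?f {k - m..<k} = ?f (k - m) + sum ?f {Suc (k - m)..<k}"
      using False assms by (intro sum.atLeast_Suc_lessThan) auto
    also have "sum ?f {Suc (k - m)..<k} = 0"
      by (intro sum.neutral) (auto simp: rev_char_coeff_def)
    also have "?f (k - m) + 0 = (-1) ^ (k - m) * (-1) ^ m *
        (int (n choose (k - m)) * int ((n - (k - m) - 1) choose (m - 1)))"
      using assms by (simp add: rev_char_coeff_def)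
    also have "(-1) ^ (k - m) * (-1) ^ m = ((-1) ^ k :: int)"
      using assms by (simp flip: power_add)
    also have "int (n choose (k - m)) * int ((n - (k - m) - 1) choose (m - 1)) = Y_coeff k n (k - m)"
      using Y_coeff_altdef[of "k - m" k n] False assms by simp
    finally show ?thesis using assms by simp
  qed (simp add: Y_coeff_def)
  finally show ?thesis by (simp add: algebra_simps)
qed

section \<open>Inverse Kazhdan-Lusztig polynomials\<close>

text \<open>For \<open>k = 0\<close> the sum would be empty, whereas the normalisation in rank 0
  demands 1.\<close>

definition uniform_Q :: "nat \<Rightarrow> nat \<Rightarrow> int poly" where
  "uniform_Q k n =
     (if k = 0 then 1 else (\<Sum>m | 2 * m < k. monom (Y_coeff k n m - Y_coeff k n (k - m)) m))"

lemma coeff_uniform_Q: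
  assumes "0 < k"
  shows "coeff (uniform_Q k n) m = (if 2 * m < k then Y_coeff k n m - Y_coeff k n (k - m) else 0)"
proof -
  have "finite {m. 2 * m < k}" by (rule finite_subset[of _ "{..<k}"]) auto
  thus ?thesis using assms by (simp add: uniform_Q_def coeff_sum)
qed

lemma degree_uniform_Q:
  assumes "0 < k"
  shows "2 * degree (uniform_Q k n) < k"
proof -
  have "degree (uniform_Q k n) \<le> (k - 1) div 2"
    by (rule degree_le) (use assms in \<open>auto simp: coeff_uniform_Q\<close>)
  thus ?thesis using assms by linarith
qed

text \<open>For \<open>k = n\<close> the number \<open>Y_coeff n n i\<close> is
  \<open>n choose i\<close> when \<open>i < n\<close>, so the differences vanish by symmetry. Only
  \<open>m = 0\<close> survives, where the guard turns the subtracted term into 0.\<close>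

lemma uniform_Q_free: "uniform_Q n n = 1"
proof (cases "n = 0")
  case False
  have "Y_coeff n n m - Y_coeff n n (n - m) = (if m = 0 then 1 else 0)" if "2 * m < n" for m
    using that binomial_symmetric[of m n] by (auto simp: Y_coeff_def)
  thus ?thesis using False by (intro poly_eqI) (auto simp: coeff_uniform_Q)
qed (simp add: uniform_Q_def)

lemma coeff_minus_one_power:
  "coeff ((-1) ^ i * p) m = (-1) ^ i * coeff p m" for p :: "'a::comm_ring_1 poly"
  by (cases "even i") auto

text \<open>The candidate depends on a matroid only through its rank and size. On independent flats
  it is 1 by \<open>uniform_Q_free\<close>, so in the sum over flats
  \<open>uniform_Q k (card E)\<close> itself enters only through the top flat.\<close>

lemma inverse_KL_conditions_uniform_on:
  assumes "finite E" "k \<le> card E" "Q = (\<lambda>M. uniform_Q (rk M) (card (ground M)))"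
  shows "inverse_KL_conditions Q (uniform_on k E)"
proof -
  let ?M = "uniform_on k E" and ?n = "card E"
  let ?R = "\<lambda>F. reverse_at (rk (contract ?M F)) (char_poly (contract ?M F))"
  let ?g = "\<lambda>F. (-1) ^ rank_of ?M F * Q (restrict ?M F) * ?R F"
  \<comment> \<open>Rebuilding the reversed characteristic polynomial from its coefficients makes it
    a function of \<open>card F\<close> alone, as \<open>sum_flats_uniform_on\<close>
    requires.\<close>
  let ?r = "\<lambda>i. Abs_poly (rev_char_coeff (k - i) (?n - i))"
  have rk: "rk ?M = k" using assms by (simp add: rk_uniform_on)
  have M: "is_matroid ?M" using is_matroid_uniform_on[OF assms(1)] .
  have R: "?R F = ?r (card F)" if F: "F \<subseteq> E" "card F < k" for F
  proof -
    have c: "card (E - F) = ?n - card F"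
      using F assms(1) finite_subset by (metis card_Diff_subset)
    have "coeff (?R F) = rev_char_coeff (k - card F) (?n - card F)"
      using F assms c coeff_reverse_char_poly_uniform_on[of "E - F" "k - card F"]
      by (auto simp: contract_uniform_on rk_uniform_on)
    thus ?thesis by (metis coeff_inverse)
  qed
  have coeff_r: "coeff (?r i) m = rev_char_coeff (k - i) (?n - i) m" for i m
  proof -
    have "\<forall>\<^sub>\<infinity>m. rev_char_coeff (k - i) (?n - i) m = 0"
      unfolding MOST_nat by (auto simp: rev_char_coeff_def intro!: exI[of _ k])
    thus ?thesis by (simp add: Abs_poly_inverse)
  qed
  have "sum ?g (flats ?M) = (\<Sum>i<k. of_nat (?n choose i) * ((-1) ^ i * ?r i)) + ?g E"
  proof (rule sum_flats_uniform_on[OF assms(1,2)])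
    fix F assume F: "F \<subseteq> E" "card F < k"
    have "finite F" using F assms finite_subset by blast
    thus "?g F = (-1) ^ card F * ?r (card F)"
      using F assms R[OF F]
      by (simp add: restrict_uniform_on rk_uniform_on uniform_Q_free rank_of_uniform_on)
  qed
  \<comment> \<open>Contracting the whole ground set leaves rank 0, whose reversed characteristic
    polynomial is 1.\<close>
  also have "?g E = (-1) ^ k * uniform_Q k ?n"
    using reverse_at_contract_ground[OF M] restrict_ground[OF M] rk assms
    by (simp add: rank_of_uniform_on)
  finally have sum: "sum ?g (flats ?M) =
      (\<Sum>i<k. of_nat (?n choose i) * ((-1) ^ i * ?r i)) + (-1) ^ k * uniform_Q k ?n" .
  have "(-1) ^ k * reverse_at k (uniform_Q k ?n) = sum ?g (flats ?M)"
  proof (cases "k = 0")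
    case True
    thus ?thesis unfolding sum by (simp add: uniform_Q_def reverse_at_def)
  next
    case False
    show ?thesis
    proof (rule poly_eqI)
      fix m
      have "coeff (sum ?g (flats ?M)) m =
          (\<Sum>i<k. int (?n choose i) * ((-1) ^ i * rev_char_coeff (k - i) (?n - i) m)) +
          (-1) ^ k * coeff (uniform_Q k ?n) m"
        unfolding sum by (simp add: coeff_sum coeff_minus_one_power coeff_r of_nat_poly)
      also have "\<dots> = (-1) ^ k * (if m \<le> k then coeff (uniform_Q k ?n) (k - m) else 0)"
      proof (cases "m \<le> k")
        case True
        \<comment> \<open>Both sides change sign under exchanging \<open>m\<close> and
          \<open>k - m\<close>. They vanish if \<open>2 * m = k\<close>; otherwise exactly one of
          the two indices lies below k/2, and only its coefficient in \<open>uniform_Q\<close> can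
          be nonzero.\<close>
        have "coeff (uniform_Q k ?n) (k - m) - coeff (uniform_Q k ?n) m =
            Y_coeff k ?n (k - m) - Y_coeff k ?n m"
        proof (cases "2 * m = k")
          case True
          hence "k - m = m" by simp
          thus ?thesis by simp
        next
          case F: False
          thus ?thesis using True False by (auto simp: coeff_uniform_Q)
        qed
        thus ?thesis
          unfolding sum_rev_char_coeff[OF assms(2) True] using True
          by (simp flip: distrib_left)
      next
        case F: False
        hence "(\<Sum>i<k. int (?n choose i) * ((-1) ^ i * rev_char_coeff (k - i) (?n - i) m)) = 0"
          by (intro sum.neutral) (auto simp: rev_char_coeff_def)
        thus ?thesis using F False by (simp add: coeff_uniform_Q)
      qed
      finally show "coeff ((-1) ^ k * reverse_at k (uniform_Q k ?n)) m = coeff (sum ?g (flats ?M)) m"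
        by (simp add: coeff_minus_one_power coeff_reverse_at)
    qed
  qed
  thus ?thesis
    using rk degree_uniform_Q[of k ?n] assms(3)
    by (auto simp: inverse_KL_conditions_def uniform_Q_def)
qed

text \<open>The local criterion \<open>inverse_KL_eqI_local\<close> suffices: every restriction to a
  flat is the matroid itself or a free matroid, so the conditions have to be checked on uniform
  matroids only.\<close>

lemma inverse_KL_uniform_on:
  assumes "finite E" "k \<le> card E"
  shows "inverse_KL (uniform_on k E) = uniform_Q k (card E)"
proof -
  let ?Q = "\<lambda>M :: 'a matroid. uniform_Q (rk M) (card (ground M))"
  have M: "is_matroid (uniform_on k E)" using is_matroid_uniform_on[OF assms(1)] .
  have "inverse_KL_conditions ?Q (restrict (uniform_on k E) F)"
    if F: "F \<in> flats (uniform_on k E)" for F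
  proof (cases "F = E")
    case True
    thus ?thesis
      using inverse_KL_conditions_uniform_on[OF assms refl] restrict_ground[OF M] by simp
  next
    case False
    hence F: "F \<subseteq> E" "card F < k" using F assms by (auto simp: flats_uniform_on)
    hence "restrict (uniform_on k E) F = uniform_on (card F) F"
      using assms by (intro restrict_uniform_on) auto
    moreover have "finite F" using F assms finite_subset by blast
    ultimately show ?thesis
      using inverse_KL_conditions_uniform_on[of F "card F", OF _ _ refl] by simp
  qed
  hence "inverse_KL (uniform_on k E) = ?Q (uniform_on k E)"
    by (intro inverse_KL_eqI_local M) blast
  thus ?thesis using assms by (simp add: rk_uniform_on)
qed

section \<open>The inverse Z-polynomial\<close>

text \<open>A proper flat of size \<open>i\<close> contributes the sign (-1)^i times a Moebius value
  of sign (-1)^(k-i). The product is (-1)^k for all flats and cancels against the sign in front of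
  \<open>Y_hat\<close>; the top flat contributes Q.\<close>

lemma coeff_inverse_Z_uniform_on:
  assumes "finite E" "0 < k" "k \<le> card E"
  shows "coeff (inverse_Z (uniform_on k E)) m =
    (if 0 < m \<and> m \<le> k then Y_coeff k (card E) (k - m) else 0) + coeff (uniform_Q k (card E)) m"
proof -
  let ?M = "uniform_on k E" and ?n = "card E"
  let ?c = "\<lambda>i. if k - i = m then int (?n choose i) * int ((?n - i - 1) choose (k - i - 1)) else 0"
  have M: "is_matroid ?M" using is_matroid_uniform_on[OF assms(1)] .
  have "Y_hat ?M = (\<Sum>i<k. of_nat (?n choose i) *
        monom ((-1) ^ k * int ((?n - i - 1) choose (k - i - 1))) (k - i)) +
      (-1) ^ rank_of ?M E * inverse_KL (restrict ?M E) *
        monom (mu (contract ?M E)) (rk (contract ?M E))"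
    unfolding Y_hat_def
  proof (rule sum_flats_uniform_on[OF assms(1,3)])
    fix F assume F: "F \<subseteq> E" "card F < k"
    have fF: "finite F" using F assms finite_subset by blast
    have c: "card (E - F) = ?n - card F"
      using F fF by (simp add: card_Diff_subset)
    have "mu (contract ?M F) = (-1) ^ (k - card F) * int ((?n - card F - 1) choose (k - card F - 1))"
      using F assms c mu_uniform_on[of "E - F" "k - card F"] by (simp add: contract_uniform_on)
    moreover have "rk (contract ?M F) = k - card F"
      using F assms c by (simp add: contract_uniform_on rk_uniform_on)
    moreover have "(-1) ^ card F * monom a i = monom ((-1) ^ card F * a) i" for a :: int and i
      by (cases "even (card F)") (auto simp: minus_monom)
    moreover have "(-1) ^ card F * (-1) ^ (k - card F) = ((-1) ^ k :: int)"
      using F by (simp flip: power_add)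
    ultimately show "(-1) ^ rank_of ?M F * inverse_KL (restrict ?M F) *
          monom (mu (contract ?M F)) (rk (contract ?M F)) =
        monom ((-1) ^ k * int ((?n - card F - 1) choose (k - card F - 1))) (k - card F)"
      using F fF assms
      by (simp add: restrict_uniform_on inverse_KL_uniform_on uniform_Q_free rank_of_uniform_on)
  qed
  also have "(-1) ^ rank_of ?M E * inverse_KL (restrict ?M E) *
        monom (mu (contract ?M E)) (rk (contract ?M E)) = (-1) ^ k * uniform_Q k ?n"
    using assms restrict_ground[OF M]
    by (simp add: rank_of_uniform_on contract_uniform_on_ground inverse_KL_uniform_on
        mu_uniform_on_0 monom_eq_1 rk_uniform_on)
  finally have "coeff (Y_hat ?M) m =
      (\<Sum>i<k. (-1) ^ k * ?c i) + (-1) ^ k * coeff (uniform_Q k ?n) m"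
    by (simp add: coeff_minus_one_power coeff_sum of_nat_poly)
      (intro sum.cong refl, auto)
  hence Y: "coeff (Y_hat ?M) m = (-1) ^ k * ((\<Sum>i<k. ?c i) + coeff (uniform_Q k ?n) m)"
    by (simp only: sum_distrib_left distrib_left)
  have "coeff (inverse_Z ?M) m = (-1) ^ k * coeff (Y_hat ?M) m"
    using assms by (simp add: inverse_Z_def loopless_uniform_on rk_uniform_on coeff_minus_one_power)
  also have "\<dots> = (\<Sum>i<k. ?c i) + coeff (uniform_Q k ?n) m"
    unfolding Y by (simp only: mult.assoc[symmetric] power_mult_distrib[symmetric]) simp
  \<comment> \<open>The inner condition is needed since for \<open>m > k\<close> truncated
    subtraction gives \<open>k - m = 0\<close>, which would select \<open>i = 0\<close>. For
    \<open>m = 0\<close> the index \<open>k - m = k\<close> is out of range.\<close>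
  also have "(\<Sum>i<k. ?c i) =
      (\<Sum>i<k. if i = k - m then (if 0 < m \<and> m \<le> k then Y_coeff k ?n (k - m) else 0) else 0)"
    using assms by (intro sum.cong refl) (auto simp: Y_coeff_altdef)
  also have "\<dots> = (if 0 < m \<and> m \<le> k then Y_coeff k ?n (k - m) else 0)"
    by simp
  finally show ?thesis .
qed

theorem theorem1p1:
  fixes k n :: nat
  assumes "1 \<le> k" "k \<le> n"
  shows "inverse_Z (uniform k n) =
      (\<Sum>i = 0..k div 2. monom (int ((n choose i) * ((n - i - 1) choose (n - k)))) i)
    + (\<Sum>i = 0..(k - 1) div 2. monom (int ((n choose i) * ((n - i - 1) choose (n - k)))) (k - i))"
  (is "_ = (\<Sum>i = 0.._. monom (?a i) i) + _")
proof (rule poly_eqI)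
  fix m
  \<comment> \<open>As \<open>k \<ge> 1\<close>, the indices in both sums are at most
    \<open>k div 2 < k\<close>, so the guard in \<open>Y_coeff\<close> never takes effect
    there.\<close>
  have wt: "?a i = Y_coeff k n i" if "i < k" for i
    using that by (simp add: Y_coeff_def)
  have "coeff (\<Sum>i = 0..k div 2. monom (?a i) i) m = (if 2 * m \<le> k then Y_coeff k n m else 0)"
    using assms wt[of m] by (auto simp: coeff_sum)
  moreover have "coeff (\<Sum>i = 0..(k - 1) div 2. monom (?a i) (k - i)) m =
      (if k < 2 * m \<and> m \<le> k then Y_coeff k n (k - m) else 0)"
  proof -
    have "coeff (\<Sum>i = 0..(k - 1) div 2. monom (?a i) (k - i)) m =
        (\<Sum>i = 0..(k - 1) div 2. if i = k - m then (if m \<le> k then Y_coeff k n (k - m) else 0) else 0)"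
      unfolding coeff_sum using assms by (intro sum.cong refl) (auto simp: Y_coeff_def)
    also have "\<dots> = (if k < 2 * m \<and> m \<le> k then Y_coeff k n (k - m) else 0)"
      using assms by auto
    finally show ?thesis .
  qed
  moreover have "coeff (inverse_Z (uniform k n)) m =
      (if 0 < m \<and> m \<le> k then Y_coeff k n (k - m) else 0) + coeff (uniform_Q k n) m"
    using coeff_inverse_Z_uniform_on[of "{1..n}" k m] assms by (simp add: uniform_eq_uniform_on)
  \<comment> \<open>At the middle index \<open>uniform_Q\<close> has coefficient 0, and the term at
    \<open>k - m\<close> has to match the term at \<open>m\<close> in the first sum.\<close>
  moreover have "k - m = m" if "2 * m = k"
    using that by simp
  \<comment> \<open>This settles \<open>m = 0\<close>, where \<open>uniform_Q\<close> subtracts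
    \<open>Y_coeff k n k\<close> and no flat term compensates for it.\<close>
  moreover have "Y_coeff k n k = 0"
    by (simp add: Y_coeff_def)
  ultimately show "coeff (inverse_Z (uniform k n)) m = coeff
      ((\<Sum>i = 0..k div 2. monom (?a i) i) + (\<Sum>i = 0..(k - 1) div 2. monom (?a i) (k - i))) m"
    using assms by (auto simp: coeff_uniform_Q)
qed

end
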